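(* Let $f$ and $g$ be the functions of $(\xi,\eta)$ defined in the context, with $\mu=\frac{59729}{19885499729}$ and $c=\frac{149896229}{10}\sqrt{\frac{1495978707}{3317816087784734}}$. Let $$x_1=\tfrac{312498189077}{625000000000},\quad x_2=\tfrac{312498095327}{625000000000},\quad y_1=\tfrac{4330127145451}{5000000000000},\quad y_3=\tfrac{43301267124383}{50000000000000},$$ so that $x_2<x_1$, $y_3<y_1$, and let $R=[x_2,x_1]\times[y_3,y_1]$. Then (i) $g>0$ on the top edge $\{(x,y_1):x\in[x_2,x_1]\}$ and $g<0$ on the bottom edge $\{(x,y_3):x\in[x_2,x_1]\}$; (ii) $f>0$ on the right edge $\{(x_1,y):y\in[y_3,y_1]\}$ and $f<0$ on the left edge $\{(x_2,y):y\in[y_3,y_1]\}$; (iii) consequently there exists a point $P_0=(\xi_0,\eta_0)\in R$ with $f(\xi_0,\eta_0)=g(\xi_0,\eta_0)=0$, i.e. $(\xi_0,\eta_0)$ is an equilibrium point of the relativistic circular restricted three-body system described in the context.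
   Context: Relativistic circular restricted three-body problem in rotating coordinates $(\xi,\eta)$ with mass parameter $\mu\in(0,1/2]$ and (normalized) speed of light $c>0$. Set $\rho=\sqrt{\xi^2+\eta^2}$, $\rho_1=\sqrt{(\xi+\mu)^2+\eta^2}$, $\rho_2=\sqrt{(\xi+\mu-1)^2+\eta^2}$, and $V=\dot\xi^2+\dot\eta^2+2(\xi\dot\eta-\dot\xi\eta)+\rho^2$. Define $$w_0=\tfrac12(\xi^2+\eta^2)+\frac{1-\mu}{\rho_1}+\frac{\mu}{\rho_2},$$ $$w_1=-\tfrac32\Big(1-\tfrac13\mu(1-\mu)\Big)\rho^2+\tfrac18V^2+\tfrac32\Big(\frac{1-\mu}{\rho_1}+\frac{\mu}{\rho_2}\Big)V-\tfrac12\Big(\frac{(1-\mu)^2}{\rho_1^2}+\frac{\mu^2}{\rho_2^2}\Big)$$ $$\qquad+\mu(1-\mu)\Big[\Big(4\dot\eta+\tfrac{7\xi}{2}\Big)\Big(\frac1{\rho_1}-\frac1{\rho_2}\Big)-\tfrac12\eta^2\Big(\frac{\mu}{\rho_1^3}+\frac{1-\mu}{\rho_2^3}\Big)+\frac{3\mu-2}{2\rho_1}-\frac{1}{\rho_1\rho_2}+\frac{1-3\mu}{2\rho_2}\Big],$$ $w=w_0+\frac1{c^2}w_1$ (a function of $\xi,\dot\xi,\eta,\dot\eta$), and $n=1-\frac{3}{2c^2}\big(1-\frac13\mu(1-\mu)\big)$. The equations of motion are $$\ddot\xi-2n\dot\eta=\frac{\partial w}{\partial\xi}-\frac{d}{dt}\Big(\frac{\partial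 w}{\partial\dot\xi}\Big),\qquad \ddot\eta+2n\dot\xi=\frac{\partial w}{\partial\eta}-\frac{d}{dt}\Big(\frac{\partial w}{\partial\dot\eta}\Big).$$ Define $f(\xi,\eta)=\frac{\partial w}{\partial\xi}$ and $g(\xi,\eta)=\frac{\partial w}{\partial\eta}$, both evaluated at $\dot\xi=\dot\eta=0$; the equilibrium points (constant solutions) of the system are exactly the common zeros of $f$ and $g$. *)

theory Defs
  imports "HOL-Analysis.Analysis"
begin

text \<open>Relativistic circular restricted three-body problem, rotating coordinates.
  Arguments of the generalized potential: xi, xi_dot, eta, eta_dot.\<close>

definition rho :: "real \<Rightarrow> real \<Rightarrow> real" where
  "rho xi eta = sqrt (xi^2 + eta^2)"

definition rho1 :: "real \<Rightarrow> real \<Rightarrow> real \<Rightarrow> real" where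
  "rho1 mu xi eta = sqrt ((xi + mu)^2 + eta^2)"

definition rho2 :: "real \<Rightarrow> real \<Rightarrow> real \<Rightarrow> real" where
  "rho2 mu xi eta = sqrt ((xi + mu - 1)^2 + eta^2)"

definition Vfun :: "real \<Rightarrow> real \<Rightarrow> real \<Rightarrow> real \<Rightarrow> real" where
  "Vfun xi xd eta ed = xd^2 + ed^2 + 2 * (xi * ed - xd * eta) + (rho xi eta)^2"

definition w0 :: "real \<Rightarrow> real \<Rightarrow> real \<Rightarrow> real" where
  "w0 mu xi eta = (1/2) * (xi^2 + eta^2) + (1 - mu) / rho1 mu xi eta + mu / rho2 mu xi eta"

definition w1 :: "real \<Rightarrow> real \<Rightarrow> real \<Rightarrow> real \<Rightarrow> real \<Rightarrow> real" where
  "w1 mu xi xd eta ed =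
     (let r = rho xi eta; r1 = rho1 mu xi eta; r2 = rho2 mu xi eta; V = Vfun xi xd eta ed in
      - (3/2) * (1 - (1/3) * mu * (1 - mu)) * r^2
      + (1/8) * V^2
      + (3/2) * ((1 - mu) / r1 + mu / r2) * V
      - (1/2) * ((1 - mu)^2 / r1^2 + mu^2 / r2^2)
      + mu * (1 - mu) *
        ( (4 * ed + 7 * xi / 2) * (1 / r1 - 1 / r2)
          - (1/2) * eta^2 * (mu / r1^3 + (1 - mu) / r2^3)
          + (3 * mu - 2) / (2 * r1)
          - 1 / (r1 * r2)
          + (1 - 3 * mu) / (2 * r2)))"

definition wfun :: "real \<Rightarrow> real \<Rightarrow> real \<Rightarrow> real \<Rightarrow> real \<Rightarrow> real \<Rightarrow> real" where
  "wfun mu c xi xd eta ed = w0 mu xi eta + (1 / c^2) * w1 mu xi xd eta ed"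

definition f_eq :: "real \<Rightarrow> real \<Rightarrow> real \<Rightarrow> real \<Rightarrow> real" where
  "f_eq mu c xi eta = deriv (\<lambda>x. wfun mu c x 0 eta 0) xi"

definition g_eq :: "real \<Rightarrow> real \<Rightarrow> real \<Rightarrow> real \<Rightarrow> real" where
  "g_eq mu c xi eta = deriv (\<lambda>y. wfun mu c xi 0 y 0) eta"

definition mu0 :: real where "mu0 = 59729 / 19885499729"

definition c0 :: real where
  "c0 = (149896229 / 10) * sqrt (1495978707 / 3317816087784734)"

end

theory Submission
  imports Defs
begin

text \<open>The rectangle has size about \<open>10^-7\<close> around the classical triangular point, where both distances
  to the primaries are 1. There the Newtonian gradient is, up to a quadratic error of order
  \<open>10^-14\<close>, affine in the two squared distances, hence affine in \<open>y^2\<close> on the vertical edges and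
  quadratic in \<open>x\<close> on the horizontal ones, and its sign is decided at a corner, with a margin of
  about \<open>2 * 10^-13\<close>. The gradient of the relativistic correction \<open>w1\<close> nearly cancels at the
  triangular point: it is below \<open>10^-5\<close>, so that after division by \<open>c^2 > 10^8\<close> it does not
  affect the signs.\<close>

section \<open>The Poincare-Miranda theorem in the plane\<close>

text \<open>Brouwer's theorem is applied to \<open>z - (f z, g z)\<close> clamped to the rectangle.
  At a fixed point an inactive clamp gives \<open>f = 0\<close> directly, while at
  \<open>x = a\<close> or \<open>x = b\<close> the clamp forces a sign of \<open>f\<close> opposite
  to the one assumed on that edge; likewise for \<open>g\<close>.\<close>

lemma poincare_miranda_plane:
  fixes f g :: "real \<times> real \<Rightarrow> real"
  assumes "a \<le> b" "c \<le> d"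
    and contf: "continuous_on ({a..b} \<times> {c..d}) f"
    and contg: "continuous_on ({a..b} \<times> {c..d}) g"
    and left: "\<And>y. y \<in> {c..d} \<Longrightarrow> f (a, y) \<le> 0"
    and right: "\<And>y. y \<in> {c..d} \<Longrightarrow> f (b, y) \<ge> 0"
    and bottom: "\<And>x. x \<in> {a..b} \<Longrightarrow> g (x, c) \<le> 0"
    and top: "\<And>x. x \<in> {a..b} \<Longrightarrow> g (x, d) \<ge> 0"
  shows "\<exists>x\<in>{a..b}. \<exists>y\<in>{c..d}. f (x, y) = 0 \<and> g (x, y) = 0"
proof -
  let ?S = "{a..b} \<times> {c..d}"
  define h where "h z = (max a (min b (fst z - f z)), max c (min d (snd z - g z)))" for z
  have "\<exists>z\<in>?S. h z = z"
  proof (rule brouwer)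
    show "continuous_on ?S h"
      unfolding h_def by (intro continuous_intros contf contg)
    show "h \<in> ?S \<rightarrow> ?S"
      using assms(1,2) by (auto simp: h_def)
  qed (use assms(1,2) in \<open>auto intro: compact_Times convex_Times\<close>)
  then obtain x y where xy: "x \<in> {a..b}" "y \<in> {c..d}" and "h (x, y) = (x, y)"
    by auto
  then have fix_x: "max a (min b (x - f (x, y))) = x" and fix_y: "max c (min d (y - g (x, y))) = y"
    by (auto simp: h_def)
  have "f (x, y) = 0"
    using fix_x left[OF xy(2)] right[OF xy(2)] xy(1)
    by (cases "x = a"; cases "x = b") (auto simp: max_def min_def split: if_splits)
  moreover have "g (x, y) = 0"
    using fix_y bottom[OF xy(1)] top[OF xy(1)] xy(2)
    by (cases "y = c"; cases "y = d") (auto simp: max_def min_def split: if_splits)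
  ultimately show ?thesis
    using xy by blast
qed

section \<open>The gradient of the potential\<close>

text \<open>The arguments \<open>p\<close> and \<open>q\<close> stand for the reciprocal distances \<open>1 / rho1\<close> and \<open>1 / rho2\<close>, in which
  everything is polynomial.\<close>

definition w0_x :: "real \<Rightarrow> real \<Rightarrow> real \<Rightarrow> real \<Rightarrow> real" where
  "w0_x mu x p q = x - (1 - mu) * (x + mu) * p^3 - mu * (x + mu - 1) * q^3"

definition w0_y :: "real \<Rightarrow> real \<Rightarrow> real \<Rightarrow> real \<Rightarrow> real" where
  "w0_y mu y p q = y - (1 - mu) * y * p^3 - mu * y * q^3"

definition w1_x :: "real \<Rightarrow> real \<Rightarrow> real \<Rightarrow> real \<Rightarrow> real \<Rightarrow> real" where
  "w1_x mu x y p q =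
     - (3 * (1 - mu * (1 - mu) / 3) * x) + (x^2 + y^2) * x / 2
     - 3 / 2 * ((1 - mu) * ((x + mu) * p^3) + mu * ((x + mu - 1) * q^3)) * (x^2 + y^2)
     + 3 * ((1 - mu) * p + mu * q) * x
     + (1 - mu)^2 * ((x + mu) * p^4) + mu^2 * ((x + mu - 1) * q^4)
     + mu * (1 - mu) *
       (7 / 2 * (p - q) + 7 / 2 * x * ((x + mu - 1) * q^3 - (x + mu) * p^3)
        + 3 / 2 * y^2 * (mu * ((x + mu) * p^5) + (1 - mu) * ((x + mu - 1) * q^5))
        - (3 * mu - 2) / 2 * ((x + mu) * p^3)
        + (x + mu) * p^3 * q + (x + mu - 1) * p * q^3
        - (1 - 3 * mu) / 2 * ((x + mu - 1) * q^3))"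

definition w1_y :: "real \<Rightarrow> real \<Rightarrow> real \<Rightarrow> real \<Rightarrow> real \<Rightarrow> real" where
  "w1_y mu x y p q =
     - (3 * (1 - mu * (1 - mu) / 3) * y) + (x^2 + y^2) * y / 2
     - 3 / 2 * ((1 - mu) * (y * p^3) + mu * (y * q^3)) * (x^2 + y^2)
     + 3 * ((1 - mu) * p + mu * q) * y
     + (1 - mu)^2 * (y * p^4) + mu^2 * (y * q^4)
     + mu * (1 - mu) *
       (7 / 2 * x * (y * q^3 - y * p^3)
        - y * (mu * p^3 + (1 - mu) * q^3)
        + 3 / 2 * y^2 * (mu * (y * p^5) + (1 - mu) * (y * q^5))
        - (3 * mu - 2) / 2 * (y * p^3)
        + y * p^3 * q + y * p * q^3
        - (1 - 3 * mu) / 2 * (y * q^3))"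

text \<open>At zero velocity \<open>Vfun\<close> reduces to \<open>x^2 + y^2\<close>, so the
  potential becomes a polynomial in \<open>x\<close>, \<open>y\<close>, \<open>p\<close>,
  \<open>q\<close>.\<close>

definition w0_rest :: "real \<Rightarrow> real \<Rightarrow> real \<Rightarrow> real \<Rightarrow> real \<Rightarrow> real" where
  "w0_rest mu x y p q = (x^2 + y^2) / 2 + (1 - mu) * p + mu * q"

definition w1_rest :: "real \<Rightarrow> real \<Rightarrow> real \<Rightarrow> real \<Rightarrow> real \<Rightarrow> real" where
  "w1_rest mu x y p q =
     - (3 / 2 * (1 - mu * (1 - mu) / 3) * (x^2 + y^2)) + (x^2 + y^2)^2 / 8
     + 3 / 2 * ((1 - mu) * p + mu * q) * (x^2 + y^2)
     - ((1 - mu)^2 * p^2 + mu^2 * q^2) / 2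
     + mu * (1 - mu) *
       (7 / 2 * x * (p - q) - y^2 / 2 * (mu * p^3 + (1 - mu) * q^3)
        + (3 * mu - 2) / 2 * p - p * q + (1 - 3 * mu) / 2 * q)"

lemma wfun_at_rest:
  "wfun mu c x 0 y 0 =
     w0_rest mu x y (1 / rho1 mu x y) (1 / rho2 mu x y)
     + w1_rest mu x y (1 / rho1 mu x y) (1 / rho2 mu x y) / c^2"
  by (simp add: wfun_def w0_def w1_def w0_rest_def w1_rest_def Vfun_def rho_def Let_def power_divide)

text \<open>Differentiating a reciprocal distance gives a multiple of its cube, so polynomials in
  the reciprocal distances stay polynomial. The shifts \<open>a = mu\<close> and
  \<open>a = mu - 1\<close> cover the two primaries.\<close>

lemma inverse_dist_derivs:
  assumes "y \<noteq> 0"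
  shows "((\<lambda>x. 1 / sqrt ((x + a)^2 + y^2)) has_real_derivative
            - ((x + a) * (1 / sqrt ((x + a)^2 + y^2))^3)) (at x)"
    and "((\<lambda>y. 1 / sqrt ((x + a)^2 + y^2)) has_real_derivative
            - (y * (1 / sqrt ((x + a)^2 + y^2))^3)) (at y)"
proof -
  let ?r = "sqrt ((x + a)^2 + y^2)"
  have pos: "(x + a)^2 + y^2 > 0" using assms by (simp add: add_nonneg_pos)
  then have r: "?r > 0" by simp
  have "((\<lambda>x. 1 / sqrt ((x + a)^2 + y^2)) has_real_derivative
            - ((inverse ?r / 2 * (2 * (x + a))) / ?r^2)) (at x)"
    using pos r by (auto intro!: derivative_eq_intros simp: power2_eq_square)
  moreover have "(inverse ?r / 2 * (2 * (x + a))) / ?r^2 = (x + a) * (1 / ?r)^3"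
    using r by (simp add: divide_simps power2_eq_square power3_eq_cube del: real_sqrt_mult_self)
  ultimately show "((\<lambda>x. 1 / sqrt ((x + a)^2 + y^2)) has_real_derivative
            - ((x + a) * (1 / ?r)^3)) (at x)"
    by (simp only:)
  have "((\<lambda>y. 1 / sqrt ((x + a)^2 + y^2)) has_real_derivative
            - ((inverse ?r / 2 * (2 * y)) / ?r^2)) (at y)"
    using pos r by (auto intro!: derivative_eq_intros simp: power2_eq_square)
  moreover have "(inverse ?r / 2 * (2 * y)) / ?r^2 = y * (1 / ?r)^3"
    using r by (simp add: divide_simps power2_eq_square power3_eq_cube del: real_sqrt_mult_self)
  ultimately show "((\<lambda>y. 1 / sqrt ((x + a)^2 + y^2)) has_real_derivative
            - (y * (1 / ?r)^3)) (at y)"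
    by (simp only:)
qed

text \<open>With \<open>p\<close> and \<open>q\<close> kept as opaque functions of known derivative,
  the chain rule leaves only a polynomial identity to check.\<close>

lemma f_eq_formula:
  assumes "y \<noteq> 0"
  shows "f_eq mu c x y = w0_x mu x (1 / rho1 mu x y) (1 / rho2 mu x y)
           + w1_x mu x y (1 / rho1 mu x y) (1 / rho2 mu x y) / c^2"
proof -
  define p where "p = (\<lambda>x. 1 / rho1 mu x y)"
  define q where "q = (\<lambda>x. 1 / rho2 mu x y)"
  have p: "(p has_real_derivative - ((x + mu) * p x ^ 3)) (at x)"
    unfolding p_def rho1_def by (rule inverse_dist_derivs[OF assms])
  have q: "(q has_real_derivative - ((x + mu - 1) * q x ^ 3)) (at x)"
    using inverse_dist_derivs(1)[OF assms, of "mu - 1" x]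
    unfolding q_def rho2_def by (simp add: add_diff_eq)
  have "((\<lambda>x. w0_rest mu x y (p x) (q x)) has_real_derivative w0_x mu x (p x) (q x)) (at x)"
    unfolding w0_rest_def
    \<comment> \<open>\<open>zero_neq_numeral[symmetric]\<close> discharges the nonzero denominators
      that the quotient rule asks for.\<close>
    by (rule derivative_eq_intros p q refl zero_neq_numeral[symmetric])+ (simp add: w0_x_def algebra_simps)
  moreover have "((\<lambda>x. w1_rest mu x y (p x) (q x)) has_real_derivative w1_x mu x y (p x) (q x)) (at x)"
    unfolding w1_rest_def
    by (rule derivative_eq_intros p q refl zero_neq_numeral[symmetric])+
      (simp add: w1_x_def, simp add: field_simps, simp add: algebra_simps eval_nat_numeral)
  ultimately have "((\<lambda>x. w0_rest mu x y (p x) (q x) + w1_rest mu x y (p x) (q x) / c^2)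
      has_real_derivative w0_x mu x (p x) (q x) + w1_x mu x y (p x) (q x) / c^2) (at x)"
    by (intro DERIV_add DERIV_cdivide)
  then show ?thesis
    unfolding f_eq_def wfun_at_rest by (simp add: DERIV_imp_deriv p_def q_def)
qed

lemma g_eq_formula:
  assumes "y \<noteq> 0"
  shows "g_eq mu c x y = w0_y mu y (1 / rho1 mu x y) (1 / rho2 mu x y)
           + w1_y mu x y (1 / rho1 mu x y) (1 / rho2 mu x y) / c^2"
proof -
  define p where "p = (\<lambda>y. 1 / rho1 mu x y)"
  define q where "q = (\<lambda>y. 1 / rho2 mu x y)"
  have p: "(p has_real_derivative - (y * p y ^ 3)) (at y)"
    unfolding p_def rho1_def by (rule inverse_dist_derivs[OF assms])
  have q: "(q has_real_derivative - (y * q y ^ 3)) (at y)"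
    using inverse_dist_derivs(2)[OF assms, of x "mu - 1"]
    unfolding q_def rho2_def by (simp add: add_diff_eq)
  have "((\<lambda>y. w0_rest mu x y (p y) (q y)) has_real_derivative w0_y mu y (p y) (q y)) (at y)"
    unfolding w0_rest_def
    by (rule derivative_eq_intros p q refl zero_neq_numeral[symmetric])+ (simp add: w0_y_def algebra_simps)
  moreover have "((\<lambda>y. w1_rest mu x y (p y) (q y)) has_real_derivative w1_y mu x y (p y) (q y)) (at y)"
    unfolding w1_rest_def
    by (rule derivative_eq_intros p q refl zero_neq_numeral[symmetric])+
      (simp add: w1_y_def, simp add: field_simps, simp add: algebra_simps eval_nat_numeral)
  ultimately have "((\<lambda>y. w0_rest mu x y (p y) (q y) + w1_rest mu x y (p y) (q y) / c^2)
      has_real_derivative w0_y mu y (p y) (q y) + w1_y mu x y (p y) (q y) / c^2) (at y)"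
    by (intro DERIV_add DERIV_cdivide)
  then show ?thesis
    unfolding g_eq_def wfun_at_rest by (simp add: DERIV_imp_deriv p_def q_def)
qed

section \<open>Numerical estimates\<close>

text \<open>Interval arithmetic in centre-radius form; as an opaque predicate it lets introduction
  rules compute centre and radius by unification.\<close>

definition approx_within :: "real \<Rightarrow> real \<Rightarrow> real \<Rightarrow> bool" where
  "approx_within u v e \<longleftrightarrow> \<bar>u - v\<bar> \<le> e"

lemma approx_within_iff: "approx_within u v e \<longleftrightarrow> v - e \<le> u \<and> u \<le> v + e"
  by (auto simp: approx_within_def abs_le_iff)

lemma approx_within_const:
  "approx_within 1 1 0" "approx_within (numeral k) (numeral k) 0"
  by (simp_all add: approx_within_def)

lemma approx_within_add:
  "approx_within u v e \<Longrightarrow> approx_within u' v' e' \<Longrightarrow> approx_within (u + u') (v + v') (e + e')"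
  by (simp add: approx_within_def)

lemma approx_within_diff:
  "approx_within u v e \<Longrightarrow> approx_within u' v' e' \<Longrightarrow> approx_within (u - u') (v - v') (e + e')"
  by (simp add: approx_within_def)

lemma approx_within_minus: "approx_within u v e \<Longrightarrow> approx_within (- u) (- v) e"
  by (simp add: approx_within_def)

lemma approx_within_mult:
  assumes "approx_within u v e" "approx_within u' v' e'"
  shows "approx_within (u * u') (v * v') (\<bar>v\<bar> * e' + \<bar>v'\<bar> * e + e * e')"
proof -
  have "u * u' - v * v' = v * (u' - v') + v' * (u - v) + (u - v) * (u' - v')"
    by (simp add: algebra_simps)
  also have "\<bar>\<dots>\<bar> \<le> \<bar>v * (u' - v')\<bar> + \<bar>v' * (u - v)\<bar> + \<bar>(u - v) * (u' - v')\<bar>"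
    by linarith
  also have "\<dots> \<le> \<bar>v\<bar> * e' + \<bar>v'\<bar> * e + e * e'"
    unfolding abs_mult using assms
    by (intro add_mono mult_mono mult_left_mono) (auto simp: approx_within_def)
  finally show ?thesis by (simp add: approx_within_def)
qed

lemma approx_within_divide_numeral:
  "approx_within u v e \<Longrightarrow> approx_within (u / numeral k) (v / numeral k) (e / numeral k)"
  by (simp add: approx_within_def divide_right_mono flip: diff_divide_distrib)

text \<open>Applied first, it leaves centre and radius schematic; the structural rules then
  instantiate them, and one numerical inequality remains.\<close>

lemma approx_within_weaken:
  "approx_within u v e \<Longrightarrow> \<bar>v - v'\<bar> + e \<le> e' \<Longrightarrow> approx_within u v' e'"
  by (simp add: approx_within_def)

lemmas approx_within_intros =
  approx_within_const approx_within_add approx_within_diff approx_within_minus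
  approx_within_mult approx_within_divide_numeral

lemma approx_within_powers:
  assumes "approx_within p 1 (12 / 10^8)"
  shows "approx_within (p^2) 1 (25 / 10^8)" "approx_within (p^3) 1 (37 / 10^8)"
    "approx_within (p^4) 1 (49 / 10^8)" "approx_within (p^5) 1 (61 / 10^8)"
proof -
  have step: "approx_within (p ^ Suc n) 1 e'"
    \<comment> \<open>Each factor adds about \<open>12 / 10^8\<close> to the radius; the final radii
      are \<open>(12 * n + 1) / 10^8\<close>.\<close>
    if "approx_within (p ^ n) 1 e" "12 / 10^8 + e + 12 / 10^8 * e \<le> e'" for n e e'
    using approx_within_weaken[OF approx_within_mult[OF assms that(1)], of 1 e'] that(2) by simp
  have 1: "approx_within (p ^ Suc 0) 1 (12 / 10^8)" using assms by simp
  have 2: "approx_within (p ^ Suc (Suc 0)) 1 (241 / 10^9)" by (rule step[OF 1]) simp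
  have 3: "approx_within (p ^ Suc (Suc (Suc 0))) 1 (362 / 10^9)" by (rule step[OF 2]) simp
  have 4: "approx_within (p ^ Suc (Suc (Suc (Suc 0)))) 1 (483 / 10^9)" by (rule step[OF 3]) simp
  have 5: "approx_within (p ^ Suc (Suc (Suc (Suc (Suc 0))))) 1 (604 / 10^9)" by (rule step[OF 4]) simp
  show "approx_within (p^2) 1 (25 / 10^8)" "approx_within (p^3) 1 (37 / 10^8)"
    "approx_within (p^4) 1 (49 / 10^8)" "approx_within (p^5) 1 (61 / 10^8)"
    using approx_within_weaken[OF 2, of 1 "25 / 10^8"] approx_within_weaken[OF 3, of 1 "37 / 10^8"]
      approx_within_weaken[OF 4, of 1 "49 / 10^8"] approx_within_weaken[OF 5, of 1 "61 / 10^8"]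
    by (simp_all add: eval_nat_numeral)
qed

text \<open>Since \<open>p\<close> is \<open>s powr (-1/2)\<close>, the deviation from 1 halves to
  first order: 11 instead of 22, with 12 absorbing the quadratic term.\<close>

lemma approx_within_one_of_square:
  assumes "p > 0" "p^2 * s = 1" "approx_within s 1 (22 / 10^8)"
  shows "approx_within p 1 (12 / 10^8)"
proof -
  have "p \<le> 1 + 12 / 10^8"
  proof (rule ccontr)
    assume "\<not> ?thesis"
    then have "(1 + 12 / 10^8)^2 \<le> p^2" by (intro power_mono) auto
    moreover have "1 - 22 / 10^8 \<le> s" using assms(3) by (simp add: approx_within_iff)
    ultimately have "(1 + 12 / 10^8)^2 * (1 - 22 / 10^8) \<le> p^2 * s"
      by (intro mult_mono) auto
    then show False using assms(2) by (simp add: power2_eq_square)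
  qed
  moreover have "p \<ge> 1 - 12 / 10^8"
  proof (rule ccontr)
    assume "\<not> ?thesis"
    then have "p^2 \<le> (1 - 12 / 10^8)^2" using assms(1) by (intro power_mono) auto
    moreover have "0 \<le> s" "s \<le> 1 + 22 / 10^8"
      using assms(3) by (simp_all add: approx_within_iff)
    ultimately have "p^2 * s \<le> (1 - 12 / 10^8)^2 * (1 + 22 / 10^8)"
      by (intro mult_mono) auto
    then show False using assms(2) by (simp add: power2_eq_square)
  qed
  ultimately show ?thesis by (simp add: approx_within_iff)
qed

text \<open>Second-order Taylor bounds for \<open>s powr (-3/2)\<close> at \<open>s = 1\<close>; cleared of denominators, both
  become polynomial inequalities in \<open>p\<close> with the double root \<open>1\<close>.\<close>

lemma cube_bounds:
  fixes p s :: real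
  assumes "p^2 * s = 1" "\<bar>p - 1\<bar> \<le> 1 / 100"
  shows "5 / 2 - 3 / 2 * s \<le> p^3" "p^3 \<le> 5 / 2 - 3 / 2 * s + 2 * (s - 1)^2"
proof -
  have p: "99 / 100 \<le> p" "p \<le> 101 / 100" using assms(2) by linarith+
  then have "p \<noteq> 0" by auto
  then have s: "s = 1 / p^2" using assms(1) by (simp add: field_simps)
  have "p^3 - (5 / 2 - 3 / 2 * s) = (p - 1)^2 * (2 * p^3 + 4 * p^2 + 6 * p + 3) / (2 * p^2)"
    unfolding s using \<open>p \<noteq> 0\<close> by (simp add: field_simps eval_nat_numeral)
  also have "\<dots> \<ge> 0" using p by (intro divide_nonneg_pos mult_nonneg_nonneg) auto
  finally show "5 / 2 - 3 / 2 * s \<le> p^3" by simp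
  have "p^n \<le> (101 / 100)^n" "(99 / 100)^n \<le> p^n" for n
    using p by (auto intro: power_mono)
  \<comment> \<open>The coefficient 2 exceeds the Taylor coefficient 15/8, so the cofactor is 1/2 at
    \<open>p = 1\<close>; endpoint bounds for each monomial keep it positive.\<close>
  from this(1)[of 5] this(1)[of 4] this(1)[of 3] this(2)[of 2]
  have "0 \<le> 2 + 4 * p + p^2 / 2 - 3 * p^3 - 2 * p^4 - p^5"
    using p by (simp add: eval_nat_numeral)
  then have "0 \<le> (p - 1)^2 * (2 + 4 * p + p^2 / 2 - 3 * p^3 - 2 * p^4 - p^5) / p^4"
    by simp
  also have "\<dots> = 5 / 2 - 3 / 2 * s + 2 * (s - 1)^2 - p^3"
    unfolding s using \<open>p \<noteq> 0\<close> by (simp add: field_simps eval_nat_numeral)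
  finally show "p^3 \<le> 5 / 2 - 3 / 2 * s + 2 * (s - 1)^2" by simp
qed

text \<open>Squaring removes the root: \<open>c0^2\<close> is rational, about
  \<open>1.013 * 10^8\<close>.\<close>

lemma inverse_c0_sq: "0 \<le> 1 / c0^2" "1 / c0^2 \<le> 1 / 10^8"
  by (simp_all add: c0_def power_mult_distrib power_divide)

section \<open>Distances to the primaries for a point of the box\<close>

locale equilibrium_box =
  fixes x y :: real
  assumes x: "312498095327 / 625000000000 \<le> x" "x \<le> 312498189077 / 625000000000"
    and y: "43301267124383 / 50000000000000 \<le> y" "y \<le> 4330127145451 / 5000000000000"
begin

definition s1 where "s1 = (x + mu0)^2 + y^2"
definition s2 where "s2 = (x + mu0 - 1)^2 + y^2"
definition p where "p = 1 / rho1 mu0 x y"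
definition q where "q = 1 / rho2 mu0 x y"

lemma approx_x: "approx_within x (49999703 / 10^8) (8 / 10^8)"
  using x by (simp add: approx_within_iff)

lemma approx_y: "approx_within y (866025386 / 10^9) (5 / 10^8)"
  using y by (simp add: approx_within_iff)

lemma approx_mu: "approx_within mu0 (3 / 10^6) (4 / 10^9)"
  by (simp add: mu0_def approx_within_iff)

lemma approx_X: "approx_within (x + mu0) (1 / 2) (11 / 10^8)"
  using x by (simp add: mu0_def approx_within_iff)

lemma approx_X1: "approx_within (x + mu0 - 1) (- 1 / 2) (11 / 10^8)"
  using x by (simp add: mu0_def approx_within_iff)

lemma y_sq:
  "(43301267124383 / 50000000000000)^2 \<le> y^2" "y^2 \<le> (4330127145451 / 5000000000000)^2"
  using y by (auto intro: power_mono)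

lemma approx_s1: "approx_within s1 1 (16 / 10^8)"
proof -
  have "(312498095327 / 625000000000 + mu0)^2 \<le> (x + mu0)^2"
    "(x + mu0)^2 \<le> (312498189077 / 625000000000 + mu0)^2"
    using x by (auto intro!: power_mono simp: mu0_def)
  with y_sq show ?thesis by (simp add: s1_def mu0_def power2_eq_square approx_within_iff)
qed

lemma approx_s2: "approx_within s2 1 (22 / 10^8)"
proof -
  \<comment> \<open>The sign is flipped because monotonicity of squares needs a nonnegative
    base.\<close>
  have "(1 - 312498189077 / 625000000000 - mu0)^2 \<le> (1 - x - mu0)^2"
    "(1 - x - mu0)^2 \<le> (1 - 312498095327 / 625000000000 - mu0)^2"
    using x by (auto intro!: power_mono simp: mu0_def)
  moreover have "(1 - x - mu0)^2 = (x + mu0 - 1)^2"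
    by (simp add: power2_eq_square algebra_simps)
  ultimately show ?thesis using y_sq by (simp add: s2_def mu0_def power2_eq_square approx_within_iff)
qed

lemma p_sq: "p^2 * s1 = 1" and p_pos: "p > 0"
proof -
  have "s1 > 0" using approx_s1 by (simp add: approx_within_iff)
  then show "p^2 * s1 = 1" "p > 0"
    by (simp_all add: p_def rho1_def power_divide flip: s1_def)
qed

lemma q_sq: "q^2 * s2 = 1" and q_pos: "q > 0"
proof -
  have "s2 > 0" using approx_s2 by (simp add: approx_within_iff)
  then show "q^2 * s2 = 1" "q > 0"
    by (simp_all add: q_def rho2_def power_divide flip: s2_def)
qed

lemma approx_p: "approx_within p 1 (12 / 10^8)"
  using approx_s1 by (intro approx_within_one_of_square[OF p_pos p_sq]) (simp add: approx_within_iff)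

lemma approx_q: "approx_within q 1 (12 / 10^8)"
  using approx_s2 by (intro approx_within_one_of_square[OF q_pos q_sq]) (simp add: approx_within_iff)

lemma p_cube: "5 / 2 - 3 / 2 * s1 \<le> p^3" "p^3 \<le> 5 / 2 - 3 / 2 * s1 + 6 / 10^14"
proof -
  have p: "\<bar>p - 1\<bar> \<le> 1 / 100" using approx_p by (simp add: approx_within_def abs_le_iff)
  show "5 / 2 - 3 / 2 * s1 \<le> p^3" by (rule cube_bounds(1)[OF p_sq p])
  have "(s1 - 1)^2 \<le> (16 / 10^8)^2" using approx_s1 unfolding approx_within_def
    by (intro abs_le_square_iff[THEN iffD1]) simp
  then show "p^3 \<le> 5 / 2 - 3 / 2 * s1 + 6 / 10^14"
    using cube_bounds(2)[OF p_sq p] by (simp add: power2_eq_square)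
qed

text \<open>The error bound may be coarser than in \<open>p_cube\<close>, because \<open>q^3\<close>
  enters the Newtonian gradient only with the factor \<open>mu0\<close>.\<close>

lemma q_cube: "5 / 2 - 3 / 2 * s2 \<le> q^3" "q^3 \<le> 5 / 2 - 3 / 2 * s2 + 1 / 10^12"
proof -
  have q: "\<bar>q - 1\<bar> \<le> 1 / 100" using approx_q by (simp add: approx_within_def)
  show "5 / 2 - 3 / 2 * s2 \<le> q^3" by (rule cube_bounds(1)[OF q_sq q])
  have "(s2 - 1)^2 \<le> (22 / 10^8)^2" using approx_s2 unfolding approx_within_def
    by (intro abs_le_square_iff[THEN iffD1]) simp
  then show "q^3 \<le> 5 / 2 - 3 / 2 * s2 + 1 / 10^12"
    using cube_bounds(2)[OF q_sq q] by (simp add: power2_eq_square)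
qed

section \<open>Size of the relativistic correction\<close>

lemma approx_squares:
  "approx_within (x^2) (24999703 / 10^8) (9 / 10^8)"
  "approx_within (y^2) (74999997 / 10^8) (9 / 10^8)"
  "approx_within (mu0^2) 0 (1 / 10^10)"
  "approx_within ((1 - mu0)^2) (999994 / 10^6) (9 / 10^9)"
  unfolding power2_eq_square
  by (rule approx_within_weaken, (rule approx_x approx_y approx_mu approx_within_intros)+, simp)+

text \<open>The order matters: stored enclosures come before the structural rules, so that they are
  used instead of a further decomposition.\<close>

lemmas approx_rules = approx_X approx_X1 approx_x approx_y approx_mu approx_p approx_q
  approx_squares approx_within_powers[OF approx_p] approx_within_powers[OF approx_q]
  approx_within_intros

text \<open>Nine decimals are kept because these terms cancel: for \<open>mu = 0\<close> at the
  triangular point they contribute -3/2 + 1/4 - 3/4 + 3/2 + 1/2 = 0.\<close>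

lemma approx_w1_x_terms:
    "approx_within (3 * (1 - mu0 * (1 - mu0) / 3) * x)
       (1499989590 / 10^9) (243 / 10^9)"
    "approx_within ((x^2 + y^2) * x / 2)
       (249997765 / 10^9) (86 / 10^9)"
    "approx_within (3 / 2 * ((1 - mu0) * ((x + mu0) * p^3) + mu0 * ((x + mu0 - 1) * q^3)) * (x^2 + y^2))
       (749993250 / 10^9) (584 / 10^9)"
    "approx_within (3 * ((1 - mu0) * p + mu0 * q) * x)
       (1499991090 / 10^9) (432 / 10^9)"
    "approx_within ((1 - mu0)^2 * ((x + mu0) * p^4))
       (499997000 / 10^9) (360 / 10^9)"
    "approx_within (mu0^2 * ((x + mu0 - 1) * q^4)) 0 (1 / 10^9)"
  by (rule approx_within_weaken, (rule approx_rules)+, simp)+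

text \<open>Rough enclosures suffice inside the bracket, which is multiplied by
  \<open>mu0 * (1 - mu0)\<close>, about \<open>3 / 10^6\<close>.\<close>

lemma approx_w1_coeffs:
  "approx_within (1 - mu0) 1 (4 / 10^6)"
  "approx_within ((3 * mu0 - 2) / 2) (-1) (5 / 10^6)"
  "approx_within ((1 - 3 * mu0) / 2) (1 / 2) (5 / 10^6)"
  by (simp_all add: mu0_def approx_within_iff)

lemma approx_w1_x_monomials:
  "approx_within ((x + mu0) * p^3) (1 / 2) (1 / 10^6)"
  "approx_within ((x + mu0 - 1) * q^3) (- 1 / 2) (1 / 10^6)"
  "approx_within ((x + mu0) * p^5) (1 / 2) (1 / 10^6)"
  "approx_within ((x + mu0 - 1) * q^5) (- 1 / 2) (1 / 10^6)"
  "approx_within ((x + mu0 - 1) * p * q^3) (- 1 / 2) (1 / 10^6)"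
  "approx_within (3 / 2 * y^2) (9 / 8) (1 / 10^6)"
  "approx_within (7 / 2 * x) (7 / 4) (2 / 10^5)"
  by (rule approx_within_weaken, (rule approx_rules)+, simp)+

lemma approx_w1_y_monomials:
  "approx_within (y * p^3) (866 / 10^3) (3 / 10^5)"
  "approx_within (y * q^3) (866 / 10^3) (3 / 10^5)"
  "approx_within (y * p^5) (866 / 10^3) (3 / 10^5)"
  "approx_within (y * q^5) (866 / 10^3) (3 / 10^5)"
  "approx_within (y * p * q^3) (866 / 10^3) (3 / 10^5)"
  by (rule approx_within_weaken, (rule approx_rules)+, simp)+

lemma approx_w1_x_bracket:
    "approx_within (7 / 2 * (p - q) + 7 / 2 * x * ((x + mu0 - 1) * q^3 - (x + mu0) * p^3)
        + 3 / 2 * y^2 * (mu0 * ((x + mu0) * p^5) + (1 - mu0) * ((x + mu0 - 1) * q^5))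
        - (3 * mu0 - 2) / 2 * ((x + mu0) * p^3)
        + (x + mu0) * p^3 * q + (x + mu0 - 1) * p * q^3
        - (1 - 3 * mu0) / 2 * ((x + mu0 - 1) * q^3))
       (- 15625 / 10^4) (3 / 10^4)"
  by (rule approx_within_weaken, (rule approx_w1_coeffs approx_w1_x_monomials approx_rules)+, simp)

lemma w1_x_bound: "\<bar>w1_x mu0 x y p q\<bar> \<le> 5 / 10^6"
proof -
  have "approx_within (w1_x mu0 x y p q) 0 (5 / 10^6)"
    unfolding w1_x_def
    by (rule approx_within_weaken, (rule approx_w1_x_terms approx_w1_x_bracket approx_rules)+, simp)
  then show ?thesis by (simp add: approx_within_def)
qed

text \<open>The same cancellation, now with coefficients -3 + 1/2 - 3/2 + 3 + 1 = 0 of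
  \<open>y\<close>.\<close>

lemma approx_w1_y_terms:
    "approx_within (3 * (1 - mu0 * (1 - mu0) / 3) * y)
       (2598073560 / 10^9) (154 / 10^9)"
    "approx_within ((x^2 + y^2) * y / 2)
       (433011394 / 10^9) (103 / 10^9)"
    "approx_within (3 / 2 * ((1 - mu0) * (y * p^3) + mu0 * (y * q^3)) * (x^2 + y^2))
       (1299034182 / 10^9) (800 / 10^9)"
    "approx_within (3 * ((1 - mu0) * p + mu0 * q) * y)
       (2598076158 / 10^9) (483 / 10^9)"
    "approx_within ((1 - mu0)^2 * (y * p^4))
       (866020190 / 10^9) (483 / 10^9)"
    "approx_within (mu0^2 * (y * q^4)) 0 (1 / 10^9)"
  by (rule approx_within_weaken, (rule approx_rules)+, simp)+

lemma approx_w1_y_bracket: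
    "approx_within (7 / 2 * x * (y * q^3 - y * p^3)
        - y * (mu0 * p^3 + (1 - mu0) * q^3)
        + 3 / 2 * y^2 * (mu0 * (y * p^5) + (1 - mu0) * (y * q^5))
        - (3 * mu0 - 2) / 2 * (y * p^3)
        + y * p^3 * q + y * p * q^3
        - (1 - 3 * mu0) / 2 * (y * q^3))
       (22733 / 10^4) (5 / 10^4)"
  by (rule approx_within_weaken, (rule approx_w1_coeffs approx_w1_x_monomials approx_w1_y_monomials approx_rules)+, simp)

lemma w1_y_bound: "\<bar>w1_y mu0 x y p q\<bar> \<le> 1 / 10^5"
proof -
  have "approx_within (w1_y mu0 x y p q) 0 (1 / 10^5)"
    unfolding w1_y_def
    by (rule approx_within_weaken, (rule approx_w1_y_terms approx_w1_y_bracket approx_rules)+, simp)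
  then show ?thesis by (simp add: approx_within_def)
qed

section \<open>Signs on the four edges\<close>

lemma f_eq_approx: "approx_within (f_eq mu0 c0 x y) (w0_x mu0 x p q) (5 / 10^14)"
proof -
  have "f_eq mu0 c0 x y - w0_x mu0 x p q = w1_x mu0 x y p q * (1 / c0^2)"
    using f_eq_formula[of y mu0 c0 x] y by (simp add: p_def q_def)
  also have "\<bar>\<dots>\<bar> \<le> 5 / 10^6 * (1 / 10^8)"
    unfolding abs_mult using w1_x_bound inverse_c0_sq by (intro mult_mono) auto
  finally show ?thesis by (simp add: approx_within_def)
qed

lemma g_eq_approx: "approx_within (g_eq mu0 c0 x y) (w0_y mu0 y p q) (1 / 10^13)"
proof -
  have "g_eq mu0 c0 x y - w0_y mu0 y p q = w1_y mu0 x y p q * (1 / c0^2)"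
    using g_eq_formula[of y mu0 c0 x] y by (simp add: p_def q_def)
  also have "\<bar>\<dots>\<bar> \<le> 1 / 10^5 * (1 / 10^8)"
    unfolding abs_mult using w1_y_bound inverse_c0_sq by (intro mult_mono) auto
  finally show ?thesis by (simp add: approx_within_def)
qed

text \<open>As \<open>x + mu0 > 0 > x + mu0 - 1\<close>, a lower bound for \<open>w0_x\<close> takes
  the upper bound of \<open>p^3\<close> and the lower bound of \<open>q^3\<close>. It increases with
  \<open>y^2\<close>, so the lower corner decides.\<close>

lemma f_pos_right:
  assumes "x = 312498189077 / 625000000000"
  shows "f_eq mu0 c0 x y > 0"
  using f_eq_approx p_cube(2) q_cube(1) y_sq(1)
  unfolding w0_x_def s1_def s2_def mu0_def approx_within_iff
  by (simp add: assms power2_eq_square algebra_simps)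

lemma f_neg_left:
  assumes "x = 312498095327 / 625000000000"
  shows "f_eq mu0 c0 x y < 0"
  using f_eq_approx p_cube(1) q_cube(2) y_sq(2)
  unfolding w0_x_def s1_def s2_def mu0_def approx_within_iff
  by (simp add: assms power2_eq_square algebra_simps)

text \<open>The weighted mean \<open>(1 - mu0) * s1 + mu0 * s2\<close> equals
  \<open>x^2 + y^2 + mu0 * (1 - mu0)\<close>, so the cube bounds give a convex quadratic in
  \<open>x\<close>, least at the left corner.\<close>

lemma g_pos_top:
  assumes "y = 4330127145451 / 5000000000000"
  shows "g_eq mu0 c0 x y > 0"
proof -
  \<comment> \<open>The tangent at the left corner; bounding \<open>x^2\<close> and \<open>x\<close> separately would lose more than the margin.\<close>
  have "(x - 312498095327 / 625000000000)^2 \<ge> 0" by simp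
  then show ?thesis
    using g_eq_approx p_cube(2) q_cube(2) x
    unfolding w0_y_def s1_def s2_def mu0_def approx_within_iff
    by (simp add: assms power2_eq_square algebra_simps)
qed

lemma g_neg_bottom:
  assumes "y = 43301267124383 / 50000000000000"
  shows "g_eq mu0 c0 x y < 0"
proof -
  \<comment> \<open>The chord bounds the convex \<open>x^2\<close> from above, and the right corner
    decides.\<close>
  have "(x - 312498095327 / 625000000000) * (x - 312498189077 / 625000000000) \<le> 0"
    using x by (simp add: mult_nonneg_nonpos)
  then show ?thesis
    using g_eq_approx p_cube(1) q_cube(1) x
    unfolding w0_y_def s1_def s2_def mu0_def approx_within_iff
    by (simp add: assms power2_eq_square algebra_simps)
qed

end

section \<open>Continuity and existence of the equilibrium\<close>

lemma continuous_on_gradient: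
  fixes x y p q :: "'a::topological_space \<Rightarrow> real"
  assumes "continuous_on S x" "continuous_on S y" "continuous_on S p" "continuous_on S q"
  shows "continuous_on S (\<lambda>z. w0_x mu (x z) (p z) (q z) + w1_x mu (x z) (y z) (p z) (q z) / c^2)"
    and "continuous_on S (\<lambda>z. w0_y mu (y z) (p z) (q z) + w1_y mu (x z) (y z) (p z) (q z) / c^2)"
  \<comment> \<open>Divisions by constants become products with constants, so no condition on
    \<open>c\<close> arises.\<close>
  unfolding w0_x_def w1_x_def w0_y_def w1_y_def divide_inverse
  by (intro continuous_intros assms)+

lemma continuous_on_equilibrium_equations:
  assumes "\<And>x y. (x, y) \<in> S \<Longrightarrow> y \<noteq> 0"
  shows "continuous_on S (\<lambda>z. f_eq mu c (fst z) (snd z))"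
    and "continuous_on S (\<lambda>z. g_eq mu c (fst z) (snd z))"
proof -
  have y: "snd z \<noteq> 0" if "z \<in> S" for z
    using assms[of "fst z" "snd z"] that by simp
  have p: "continuous_on S (\<lambda>z. 1 / rho1 mu (fst z) (snd z))"
    unfolding rho1_def using y by (intro continuous_intros) (simp add: add_nonneg_eq_0_iff)
  have q: "continuous_on S (\<lambda>z. 1 / rho2 mu (fst z) (snd z))"
    unfolding rho2_def using y by (intro continuous_intros) (simp add: add_nonneg_eq_0_iff)
  have xy: "continuous_on S fst" "continuous_on S snd"
    by (intro continuous_intros)+
  show "continuous_on S (\<lambda>z. f_eq mu c (fst z) (snd z))"
    using continuous_on_gradient(1)[OF xy p q, of mu c] continuous_on_cong[OF refl f_eq_formula[OF y]]
    by fast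
  show "continuous_on S (\<lambda>z. g_eq mu c (fst z) (snd z))"
    using continuous_on_gradient(2)[OF xy p q, of mu c] continuous_on_cong[OF refl g_eq_formula[OF y]]
    by fast
qed

theorem mainTheorem1:
  fixes x1 x2 y1 y3 :: real
  assumes "x1 = 312498189077 / 625000000000"
      and "x2 = 312498095327 / 625000000000"
      and "y1 = 4330127145451 / 5000000000000"
      and "y3 = 43301267124383 / 50000000000000"
  shows "(\<forall>x\<in>{x2..x1}. g_eq mu0 c0 x y1 > 0) \<and> (\<forall>x\<in>{x2..x1}. g_eq mu0 c0 x y3 < 0)
       \<and> (\<forall>y\<in>{y3..y1}. f_eq mu0 c0 x1 y > 0) \<and> (\<forall>y\<in>{y3..y1}. f_eq mu0 c0 x2 y < 0)
       \<and> (\<exists>xi0 eta0. xi0 \<in> {x2..x1} \<and> eta0 \<in> {y3..y1}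
            \<and> f_eq mu0 c0 xi0 eta0 = 0 \<and> g_eq mu0 c0 xi0 eta0 = 0)"
proof -
  \<comment> \<open>\<open>0 < y3\<close> keeps the box off the axis \<open>y = 0\<close> that
    carries the primaries, as continuity requires.\<close>
  have order: "x2 \<le> x1" "y3 \<le> y1" "0 < y3" using assms by auto
  have box: "equilibrium_box x y" if "x \<in> {x2..x1}" "y \<in> {y3..y1}" for x y
    using that assms by unfold_locales auto
  have top: "g_eq mu0 c0 x y1 > 0" if "x \<in> {x2..x1}" for x
    using equilibrium_box.g_pos_top[OF box[OF that]] order assms by simp
  have bottom: "g_eq mu0 c0 x y3 < 0" if "x \<in> {x2..x1}" for x
    using equilibrium_box.g_neg_bottom[OF box[OF that]] order assms by simp
  have right: "f_eq mu0 c0 x1 y > 0" if "y \<in> {y3..y1}" for y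
    using equilibrium_box.f_pos_right[OF box[OF _ that]] order assms by simp
  have left: "f_eq mu0 c0 x2 y < 0" if "y \<in> {y3..y1}" for y
    using equilibrium_box.f_neg_left[OF box[OF _ that]] order assms by simp
  have "\<exists>x\<in>{x2..x1}. \<exists>y\<in>{y3..y1}.
      (\<lambda>z. f_eq mu0 c0 (fst z) (snd z)) (x, y) = 0 \<and> (\<lambda>z. g_eq mu0 c0 (fst z) (snd z)) (x, y) = 0"
    using order top bottom right left
    by (intro poincare_miranda_plane continuous_on_equilibrium_equations) (auto intro: less_imp_le)
  then show ?thesis
    using top bottom right left by (auto simp del: atLeastAtMost_iff)
qed

end
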